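(* Let $q>3$ be a prime power, let $t>1$ be an integer, and let $f(x),f'(x)\in\mathbb F_{q^t}[x]$ be scattered $\mathbb F_q$-linearized polynomials. A bijection $\alpha:\mathbb F_{q^t}^2\to\mathbb F_{q^t}^2$ is an isomorphism between the translation planes $\mathcal A_f$ and $\mathcal A_{f'}$ if and only if there exist a vector $u\in\mathbb F_{q^t}^2$, an element $h'\in\mathbb F_{q^t}^*$ and a bijective $\mathbb F_{q^t}$-semilinear map $\lambda:\mathbb F_{q^t}^2\to\mathbb F_{q^t}^2$ such that $\lambda(U_f)=h'U_{f'}$ and $\alpha(v)=\lambda(v)+u$ for all $v\in\mathbb F_{q^t}^2$. Therefore, the planes $\mathcal A_f$ and $\mathcal A_{f'}$ are isomorphic if and only if $U_f$ and $U_{f'}$ belong to the same orbit under the action of $\Gamma\mathrm L(2,q^t)$ (the group of all bijective $\mathbb F_{q^t}$-semilinear maps of $\mathbb F_{q^t}^2$, acting on $\mathbb F_q$-subspaces of $\mathbb F_{q^t}^2$).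
   Context: An $\mathbb F_q$-linearized polynomial in $\mathbb F_{q^t}[x]$ is one of the form $f(x)=\sum_{i=0}^k a_ix^{q^i}$. It is called scattered if for all $y,z\in\mathbb F_{q^t}$ the condition $zf(y)-yf(z)=0$ implies that $y$ and $z$ are linearly dependent over $\mathbb F_q$. For a scattered $\mathbb F_q$-linearized polynomial $f(x)$ put $U_f=\{(x,f(x)) : x\in\mathbb F_{q^t}\}$, an $\mathbb F_q$-subspace of $\mathbb F_{q^t}^2$, and $L_f=\{f(x)/x : x\in\mathbb F_{q^t}^*\}\subseteq\mathbb F_{q^t}$. For $h\in\mathbb F_{q^t}^*$, $hU_f=\{hv: v\in U_f\}$. A planar spread of a vector space $\mathbb V$ is a collection $\mathcal B$ of at least three subspaces such that $\mathbb V=V\oplus V'$ for all distinct $V,V'\in\mathcal B$ and every vector of $\mathbb V$ lies in some member of $\mathcal B$. The translation plane $\mathcal A(\mathcal B)$ is the affine plane whose points are the vectors of $\mathbb V$ and whose lines are the cosets $V+w$ ($V\in\mathcal B$, $w\in\mathbb V$). Let $\mathcal B_f$ be the collection consisting of the following subspaces of $\mathbb F_{q^t}^2$: $\langle(1,m)\rangle_{\mathbb F_{q^t}}$ for $m\in\mathbb F_{q^t}\setminus L_f$; $hU_f$ for $h\in\mathbb F_{q^t}^*$; and $\{0\}\times\mathbb F_{q^t}$. This is a planar spread of $\mathbb F_{q^t}^2$ (as an $\mathbb F_q$-vector space), and the translation plane associated with $f$ is $\mathcal A_f=\mathcal A(\mathcal B_f)$. An isomorphism of planes is a bijection between the point sets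 that maps lines onto lines (in both directions). *)

theory Defs
  imports
    "HOL-Number_Theory.Prime_Powers"
    "HOL-Computational_Algebra.Polynomial"
    "HOL-Library.Product_Plus"
    "HOL-Library.Cardinality"
begin

text \<open>The field of order \<open>q ^ t\<close> is a type \<open>'a :: {field,finite}\<close> with \<open>CARD('a) = q ^ t\<close>,
  and \<open>V2\<close> below is the two-dimensional space \<open>'a \<times> 'a\<close> over it.\<close>

definition vscale :: "'a::field \<Rightarrow> 'a \<times> 'a \<Rightarrow> 'a \<times> 'a" where
  "vscale c v = (c * fst v, c * snd v)"

interpretation V2: vector_space "vscale :: 'a::field \<Rightarrow> 'a \<times> 'a \<Rightarrow> 'a \<times> 'a"
  by unfold_locales (auto simp: vscale_def algebra_simps)

text \<open>In a field of order \<open>q ^ t\<close> with \<open>q\<close> a prime power, the unique subfield of order \<open>q\<close>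
  is the set of fixed points of \<open>x \<mapsto> x ^ q\<close>.\<close>

definition Fq :: "nat \<Rightarrow> 'a::field set" where
  "Fq q = {c. c ^ q = c}"

definition lin_dependent_Fq :: "nat \<Rightarrow> 'a::field \<Rightarrow> 'a \<Rightarrow> bool" where
  "lin_dependent_Fq q y z \<longleftrightarrow>
     (\<exists>a\<in>Fq q. \<exists>b\<in>Fq q. (a \<noteq> 0 \<or> b \<noteq> 0) \<and> a * y + b * z = 0)"

definition linearized :: "nat \<Rightarrow> 'a::field poly \<Rightarrow> bool" where
  "linearized q f \<longleftrightarrow> (\<exists>k a. f = (\<Sum>i\<le>k. monom (a i) (q ^ i)))"

definition scattered :: "nat \<Rightarrow> 'a::field poly \<Rightarrow> bool" where
  "scattered q f \<longleftrightarrow>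
     (\<forall>y z. z * poly f y - y * poly f z = 0 \<longrightarrow> lin_dependent_Fq q y z)"

definition U_set :: "'a::field poly \<Rightarrow> ('a \<times> 'a) set" where
  "U_set f = {(x, poly f x) | x. True}"

definition L_set :: "'a::field poly \<Rightarrow> 'a set" where
  "L_set f = {poly f x / x | x. x \<noteq> 0}"

definition spread_of :: "'a::field poly \<Rightarrow> ('a \<times> 'a) set set" where
  "spread_of f =
     {V2.span {(1, m)} | m. m \<notin> L_set f} \<union>
     {vscale h ` U_set f | h. h \<noteq> 0} \<union>
     {{0} \<times> UNIV}"

record 'p plane =
  points :: "'p set"
  lines :: "'p set set"

definition translation_plane :: "'v::ab_group_add set set \<Rightarrow> 'v plane" where
  "translation_plane B = \<lparr>points = UNIV, lines = {(\<lambda>v. v + w) ` V | V w. V \<in> B}\<rparr>"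

text \<open>\<open>translation_plane\<close> makes sense for any collection of subsets; for a scattered linearized
  polynomial \<open>f\<close> the collection \<open>spread_of f\<close> is a planar spread, so \<open>plane_of f\<close> is an affine plane.\<close>

definition plane_of :: "'a::field poly \<Rightarrow> ('a \<times> 'a) plane" where
  "plane_of f = translation_plane (spread_of f)"

definition plane_isomorphism :: "'p plane \<Rightarrow> 'r plane \<Rightarrow> ('p \<Rightarrow> 'r) \<Rightarrow> bool" where
  "plane_isomorphism A A' \<alpha> \<longleftrightarrow>
     bij_betw \<alpha> (points A) (points A') \<and>
     (\<forall>l\<in>lines A. \<alpha> ` l \<in> lines A') \<and>
     (\<forall>l'\<in>lines A'. inv_into (points A) \<alpha> ` l' \<in> lines A)"

definition isomorphic_planes :: "'p plane \<Rightarrow> 'r plane \<Rightarrow> bool" where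
  "isomorphic_planes A A' \<longleftrightarrow> (\<exists>\<alpha>. plane_isomorphism A A' \<alpha>)"

definition field_automorphism :: "('a::field \<Rightarrow> 'a) \<Rightarrow> bool" where
  "field_automorphism \<sigma> \<longleftrightarrow>
     bij \<sigma> \<and> \<sigma> 1 = 1 \<and>
     (\<forall>x y. \<sigma> (x + y) = \<sigma> x + \<sigma> y) \<and> (\<forall>x y. \<sigma> (x * y) = \<sigma> x * \<sigma> y)"

definition semilinear :: "('a::field \<times> 'a \<Rightarrow> 'a \<times> 'a) \<Rightarrow> bool" where
  "semilinear \<phi> \<longleftrightarrow>
     (\<forall>v w. \<phi> (v + w) = \<phi> v + \<phi> w) \<and>
     (\<exists>\<sigma>. field_automorphism \<sigma> \<and> (\<forall>c v. \<phi> (vscale c v) = vscale (\<sigma> c) (\<phi> v)))"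

definition GammaL2 :: "('a::field \<times> 'a \<Rightarrow> 'a \<times> 'a) set" where
  "GammaL2 = {\<phi>. bij \<phi> \<and> semilinear \<phi>}"

definition GammaL2_orbit :: "('a::field \<times> 'a) set \<Rightarrow> ('a \<times> 'a) set set" where
  "GammaL2_orbit W = {\<phi> ` W | \<phi>. \<phi> \<in> GammaL2}"

end

theory Submission
  imports Defs
begin

text \<open>An isomorphism of translation planes preserves parallelograms, so up to a translation it is an
  additive map \<open>\<phi>\<close> between the spreads. Each spread has only \<open>(q ^ t - 1) / (q - 1)\<close> members \<open>h U\<^sub>f\<close>,
  so for \<open>q > 3\<close> more than a third of all members are lines over the big field sent to such lines.
  In suitable coordinates \<open>\<phi>\<close> acts as one additive map \<open>A\<close> on both entries, and the \<open>m\<close> with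
  \<open>A (x m) = A x A m\<close> for all \<open>x\<close> form a subfield with more than \<open>q ^ (t / 2)\<close> elements, hence
  everything: \<open>\<phi>\<close> is semilinear. Since \<open>U\<^sub>f\<close> is not a subspace over the big field, \<open>\<phi>\<close>
  must send it to some \<open>h' U\<^sub>f\<^sub>'\<close>.\<close>

section \<open>Isomorphisms of translation planes\<close>

text \<open>Members enter as additive subgroups only. \<open>meet\<close> and \<open>join\<close>
  together say that two distinct members are complementary; \<open>cover\<close> and
  \<open>meet\<close> give each nonzero vector exactly one member.\<close>

locale planar_spread =
  fixes B :: "'v::ab_group_add set set"
  assumes zero_mem: "V \<in> B \<Longrightarrow> 0 \<in> V"
    and diff_mem: "V \<in> B \<Longrightarrow> x \<in> V \<Longrightarrow> y \<in> V \<Longrightarrow> x - y \<in> V"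
    and proper: "V \<in> B \<Longrightarrow> V \<noteq> UNIV"
    and cover: "\<exists>V\<in>B. x \<in> V"
    and meet: "V \<in> B \<Longrightarrow> W \<in> B \<Longrightarrow> x \<in> V \<Longrightarrow> x \<in> W \<Longrightarrow> x \<noteq> 0 \<Longrightarrow> V = W"
    and join: "V \<in> B \<Longrightarrow> W \<in> B \<Longrightarrow> V \<noteq> W \<Longrightarrow> \<exists>v\<in>V. \<exists>w\<in>W. x = v + w"
begin

lemma uminus_mem: "V \<in> B \<Longrightarrow> x \<in> V \<Longrightarrow> - x \<in> V"
  using diff_mem[of V 0 x] zero_mem by simp

lemma uminus_mem_iff: "V \<in> B \<Longrightarrow> - x \<in> V \<longleftrightarrow> x \<in> V"
  using uminus_mem[of V x] uminus_mem[of V "- x"] by auto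

lemma add_mem: "V \<in> B \<Longrightarrow> x \<in> V \<Longrightarrow> y \<in> V \<Longrightarrow> x + y \<in> V"
  using diff_mem[of V x "- y"] uminus_mem by simp

lemma coset_eq:
  assumes "V \<in> B" "a \<in> (\<lambda>v. v + w) ` V"
  shows "(\<lambda>v. v + w) ` V = (\<lambda>v. v + a) ` V"
proof -
  obtain b where b: "b \<in> V" "a = b + w" using assms(2) by auto
  have "v + w \<in> (\<lambda>v. v + a) ` V" if "v \<in> V" for v
    using diff_mem[OF assms(1) that b(1)] b(2) by (intro image_eqI[of _ _ "v - b"]) auto
  moreover have "v + a \<in> (\<lambda>v. v + w) ` V" if "v \<in> V" for v
    using add_mem[OF assms(1) that b(1)] b(2) by (intro image_eqI[of _ _ "v + b"]) (auto simp: add_ac)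
  ultimately show ?thesis by auto
qed

end

text \<open>Vectors from different members span a parallelogram whose fourth vertex is the
  intersection of two lines parallel to its sides, so preserving lines and parallelism determines
  the image of their sum. Sums inside one member are reduced to these by an auxiliary vector outside
  it.\<close>

lemma translation_plane_isomorphism_additive:
  fixes B :: "'v::ab_group_add set set" and B' :: "'w::ab_group_add set set"
  assumes "planar_spread B" "planar_spread B'"
    and iso: "plane_isomorphism (translation_plane B) (translation_plane B') \<alpha>"
  defines "\<beta> \<equiv> \<lambda>v. \<alpha> v - \<alpha> 0"
  shows "bij \<beta>" and "\<And>V. V \<in> B \<Longrightarrow> \<beta> ` V \<in> B'" and "\<And>v w. \<beta> (v + w) = \<beta> v + \<beta> w"
proof -
  interpret S: planar_spread B by fact
  interpret S': planar_spread B' by fact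
  have bij\<alpha>: "bij \<alpha>"
    using iso by (simp add: plane_isomorphism_def translation_plane_def)
  have "bij (\<lambda>x. x - \<alpha> 0)"
    by (rule bij_betw_byWitness[of _ "\<lambda>x. x + \<alpha> 0"]) auto
  then have "bij ((\<lambda>x. x - \<alpha> 0) \<circ> \<alpha>)"
    using bij\<alpha> by (intro bij_comp)
  then show bij: "bij \<beta>"
    by (simp add: \<beta>_def comp_def)
  then have inj: "\<beta> x = \<beta> y \<longleftrightarrow> x = y" for x y
    by (auto dest: bij_is_inj injD)
  have \<beta>0 [simp]: "\<beta> 0 = 0"
    by (simp add: \<beta>_def)
  \<comment> \<open>The image of a coset has some direction \<open>X\<close>, which so far may
    depend on \<open>w\<close>.\<close>
  have coset: "\<exists>X\<in>B'. \<beta> ` (\<lambda>v. v + w) ` V = (\<lambda>v. v + \<beta> w) ` X" if V: "V \<in> B" for V w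
  proof -
    have "(\<lambda>v. v + w) ` V \<in> lines (translation_plane B)"
      using V by (auto simp: translation_plane_def)
    then have "\<alpha> ` (\<lambda>v. v + w) ` V \<in> lines (translation_plane B')"
      using iso by (simp add: plane_isomorphism_def)
    then obtain X w' where X: "X \<in> B'" "\<alpha> ` (\<lambda>v. v + w) ` V = (\<lambda>v. v + w') ` X"
      by (auto simp: translation_plane_def)
    have "0 + w \<in> (\<lambda>v. v + w) ` V"
      using S.zero_mem[OF V] by (rule imageI)
    then have "\<alpha> w \<in> \<alpha> ` (\<lambda>v. v + w) ` V"
      by simp
    then have eq: "\<alpha> ` (\<lambda>v. v + w) ` V = (\<lambda>v. v + \<alpha> w) ` X"
      using X S'.coset_eq[OF X(1), of "\<alpha> w" w'] by simp
    have "\<beta> ` (\<lambda>v. v + w) ` V = (\<lambda>x. x - \<alpha> 0) ` \<alpha> ` (\<lambda>v. v + w) ` V"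
      by (simp add: \<beta>_def image_image)
    also have "\<dots> = (\<lambda>v. v + \<beta> w) ` X"
      unfolding eq by (simp add: \<beta>_def image_image algebra_simps)
    finally show ?thesis using X(1) by blast
  qed
  show comp: "\<beta> ` V \<in> B'" if "V \<in> B" for V
    using coset[OF that, of 0] by auto
  \<comment> \<open>Parallelism is preserved: the direction does not depend on
    \<open>w\<close>.\<close>
  have coset_image: "\<beta> ` (\<lambda>v. v + w) ` V = (\<lambda>v. v + \<beta> w) ` \<beta> ` V" if V: "V \<in> B" for V w
  proof -
    obtain X where X: "X \<in> B'" "\<beta> ` (\<lambda>v. v + w) ` V = (\<lambda>v. v + \<beta> w) ` X"
      using coset[OF V, of w] by (elim bexE)
    have "X = \<beta> ` V"
    proof (cases "w \<in> V")
      case True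
      have "- w \<in> V" using S.uminus_mem[OF V True] .
      then have "- w + w \<in> (\<lambda>v. v + w) ` V" by (rule imageI)
      then have "0 \<in> (\<lambda>v. v + w) ` V" by simp
      then have "\<beta> ` (\<lambda>v. v + w) ` V = \<beta> ` V"
        using S.coset_eq[OF V, of 0 w] by simp
      moreover have "0 \<in> (\<lambda>v. v + \<beta> w) ` X"
        using \<open>0 \<in> (\<lambda>v. v + w) ` V\<close> X(2) \<beta>0 by (metis imageI)
      then have "(\<lambda>v. v + \<beta> w) ` X = X"
        using S'.coset_eq[OF X(1), of 0 "\<beta> w"] by simp
      ultimately show ?thesis using X(2) by simp
    next
      case False
      show ?thesis
      proof (rule ccontr)
        assume "X \<noteq> \<beta> ` V"
        \<comment> \<open>Cosets of different members intersect, here in \<open>b\<close>; but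
          \<open>V\<close> and its translate by \<open>w\<close> are disjoint, and so are their
          images.\<close>
        then obtain a b where ab: "a \<in> X" "b \<in> \<beta> ` V" "\<beta> w = a + b"
          using S'.join[OF X(1) comp[OF V]] by blast
        have "- a + \<beta> w \<in> (\<lambda>v. v + \<beta> w) ` X"
          using S'.uminus_mem[OF X(1) ab(1)] by (rule imageI)
        then have "b \<in> \<beta> ` (\<lambda>v. v + w) ` V"
          using ab(3) X(2) by simp
        then obtain v v' where v: "v \<in> V" "v' \<in> V" "v + w = v'"
          using ab(2) by (auto simp: inj)
        then have "w = v' - v" by auto
        then show False using False v S.diff_mem[OF V] by blast
      qed
    qed
    then show ?thesis using X(2) by simp
  qed
  \<comment> \<open>For \<open>v\<close> and \<open>w\<close> in different members the defect of
    additivity lies in the images of both members, hence vanishes.\<close>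
  have add_indep: "\<beta> (v + w) = \<beta> v + \<beta> w"
    if indep: "\<And>V. V \<in> B \<Longrightarrow> v \<in> V \<Longrightarrow> w \<notin> V" for v w
  proof -
    obtain V W where V: "V \<in> B" "v \<in> V" and W: "W \<in> B" "w \<in> W"
      using S.cover by blast
    have "V \<noteq> W" using indep V W by blast
    then have ne: "\<beta> ` V \<noteq> \<beta> ` W"
      using bij by (simp add: bij_is_inj inj_image_eq_iff)
    have "\<beta> (v + w) \<in> \<beta> ` (\<lambda>v. v + w) ` V" using V by auto
    then have "\<beta> (v + w) - \<beta> w \<in> \<beta> ` V"
      unfolding coset_image[OF V(1)] by auto
    then have 1: "\<beta> (v + w) - \<beta> w - \<beta> v \<in> \<beta> ` V"
      using S'.diff_mem[OF comp[OF V(1)]] V by blast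
    have "\<beta> (w + v) \<in> \<beta> ` (\<lambda>w. w + v) ` W" using W by auto
    then have "\<beta> (w + v) - \<beta> v \<in> \<beta> ` W"
      unfolding coset_image[OF W(1)] by auto
    then have "\<beta> (w + v) - \<beta> v - \<beta> w \<in> \<beta> ` W"
      using S'.diff_mem[OF comp[OF W(1)]] W by blast
    then have 2: "\<beta> (v + w) - \<beta> w - \<beta> v \<in> \<beta> ` W"
      by (simp add: add.commute diff_diff_add)
    have "\<beta> (v + w) - \<beta> w - \<beta> v = 0"
      using S'.meet[OF comp[OF V(1)] comp[OF W(1)] 1 2] ne by blast
    then show ?thesis by (simp add: algebra_simps)
  qed
  \<comment> \<open>A vector \<open>v\<close> outside the member of \<open>z\<close> is written as
    \<open>(v + z) + (- z)\<close>; the terms of this sum and of \<open>v + z\<close> lie in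
    different members.\<close>
  have uminus: "\<beta> (- z) = - \<beta> z" for z
  proof -
    obtain V where V: "V \<in> B" "z \<in> V" using S.cover by blast
    obtain v where v: "v \<notin> V" using S.proper[OF V(1)] by blast
    have indep: "W = V" if "W \<in> B" "z \<in> W" "z \<noteq> 0" for W
      using S.meet that V by blast
    show ?thesis
    proof (cases "z = 0")
      case False
      have "\<beta> (v + z + - z) = \<beta> (v + z) + \<beta> (- z)"
      proof (rule add_indep)
        fix W assume W: "W \<in> B" "v + z \<in> W"
        show "- z \<notin> W"
        proof
          assume "- z \<in> W"
          then have "z \<in> W" using W S.uminus_mem_iff by blast
          then have "W = V" using indep W False by blast
          moreover have "v + z - z \<in> W" using S.diff_mem W \<open>z \<in> W\<close> by blast
          ultimately show False using v by simp
        qed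
      qed
      moreover have "\<beta> (v + z) = \<beta> v + \<beta> z"
        using indep v False by (intro add_indep) blast
      ultimately show ?thesis by (simp add: eq_neg_iff_add_eq_0 add_ac)
    qed simp
  qed
  show "\<beta> (v + w) = \<beta> v + \<beta> w" for v w
  proof (cases "\<exists>V\<in>B. v \<in> V \<and> w \<in> V")
    case False
    then show ?thesis by (intro add_indep) blast
  next
    case True
    then obtain V where V: "V \<in> B" "v \<in> V" "w \<in> V" by blast
    have V_eq: "X = V" if "X \<in> B" "x \<in> X" "x \<in> V" "x \<noteq> 0" for X x
      using S.meet that V by blast
    consider "v = 0" | "w = 0" | "v + w = 0" | "v \<noteq> 0" "w \<noteq> 0" "v + w \<noteq> 0" by blast
    then show ?thesis
    proof cases
      case 3
      then have "w = - v" by (simp add: eq_neg_iff_add_eq_0 add.commute)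
      then show ?thesis using uminus by simp
    next
      case 4
      \<comment> \<open>Inserting \<open>z\<close> and \<open>- z\<close> breaks
        \<open>v + w\<close> into sums whose terms lie in different members; for
        \<open>v + z\<close> and \<open>w + - z\<close> this rests on
        \<open>v + w \<noteq> 0\<close>.\<close>
      obtain z where z: "z \<notin> V" using S.proper[OF V(1)] by blast
      have "v + w = (v + z) + (w + - z)" by simp
      moreover have "\<beta> ((v + z) + (w + - z)) = \<beta> (v + z) + \<beta> (w + - z)"
      proof (rule add_indep)
        fix X assume X: "X \<in> B" "v + z \<in> X"
        show "w + - z \<notin> X"
        proof
          assume "w + - z \<in> X"
          then have "v + z + (w + - z) \<in> X" using S.add_mem X by blast
          then have "v + w \<in> X" by simp
          then have "X = V" using V_eq[of X "v + w"] X(1) 4 S.add_mem V by blast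
          then have "v + z - v \<in> V" using S.diff_mem V X by blast
          then show False using z by simp
        qed
      qed
      moreover have "\<beta> (v + z) = \<beta> v + \<beta> z"
        using V_eq 4 V z by (intro add_indep) blast
      moreover have "\<beta> (w + - z) = \<beta> w + \<beta> (- z)"
        using V_eq 4 V z S.uminus_mem_iff by (intro add_indep) blast
      ultimately show ?thesis by (simp add: uminus)
    qed simp_all
  qed
qed

section \<open>Additive maps preserving many lines through the origin\<close>

text \<open>The explicit range yields the scalar of an element at once; \<open>span_eq_line\<close>
  identifies it with the span of \<open>v\<close>.\<close>

definition line :: "'a::field \<times> 'a \<Rightarrow> ('a \<times> 'a) set" where
  "line v = range (\<lambda>c. vscale c v)"

lemma vscale_simps:
  "vscale a (vscale b v) = vscale (a * b) v"
  "vscale 1 v = v" "vscale 0 v = 0" "vscale a 0 = 0"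
  "vscale a (v + w) = vscale a v + vscale a w"
  "vscale a (v - w) = vscale a v - vscale a w"
  "vscale (a + b) v = vscale a v + vscale b v"
  by (auto simp: vscale_def algebra_simps zero_prod_def)

lemma vscale_eq_0_iff: "vscale a v = 0 \<longleftrightarrow> a = 0 \<or> v = 0"
  by (auto simp: vscale_def zero_prod_def prod_eq_iff)

lemma vscale_right_cancel: "v \<noteq> 0 \<Longrightarrow> vscale a v = vscale b v \<longleftrightarrow> a = b"
  by (auto simp: vscale_def zero_prod_def prod_eq_iff)

lemma line_self: "v \<in> line v"
  unfolding line_def by (intro image_eqI[of _ _ 1]) (auto simp: vscale_simps)

lemma line_eq:
  assumes "w \<in> line v" "w \<noteq> 0"
  shows "line w = line v"
proof -
  obtain c where c: "w = vscale c v" using assms(1) by (auto simp: line_def)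
  then have "c \<noteq> 0" using assms(2) by (auto simp: vscale_simps)
  have "vscale a v = vscale (a / c) w" for a
    using \<open>c \<noteq> 0\<close> by (simp add: c vscale_simps)
  then have "vscale a v \<in> line w" for a
    unfolding line_def by blast
  moreover have "vscale a w \<in> line v" for a
    unfolding c vscale_simps line_def by blast
  ultimately show ?thesis unfolding line_def by blast
qed

text \<open>Independence makes the coordinates unique; they exist because an injective map of the
  finite set \<open>'a \<times> 'a\<close> into itself is onto.\<close>

lemma independent_decompose:
  fixes v w :: "'a::{field,finite} \<times> 'a"
  assumes "v \<noteq> 0" "w \<noteq> 0" "w \<notin> line v"
  shows "\<exists>x y. u = vscale x v + vscale y w"
    and "vscale a v + vscale b w = vscale c v + vscale d w \<longleftrightarrow> a = c \<and> b = d"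
proof -
  have eq: "a = c \<and> b = d" if "vscale a v + vscale b w = vscale c v + vscale d w" for a b c d
  proof -
    have *: "vscale (b - d) w = vscale (c - a) v"
      using that by (auto simp: vscale_def prod_eq_iff algebra_simps)
    have "b = d"
    proof (rule ccontr)
      assume "b \<noteq> d"
      have "w = vscale (1 / (b - d)) (vscale (b - d) w)"
        using \<open>b \<noteq> d\<close> by (simp add: vscale_simps)
      also have "\<dots> \<in> line v"
        unfolding * vscale_simps line_def by blast
      finally show False using assms(3) by simp
    qed
    then show ?thesis using that assms(1) by (auto simp: vscale_right_cancel)
  qed
  then show "vscale a v + vscale b w = vscale c v + vscale d w \<longleftrightarrow> a = c \<and> b = d" by blast
  have "inj (\<lambda>(x, y). vscale x v + vscale y w)"
    using eq by (auto simp: inj_def)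
  then have "surj (\<lambda>(x, y). vscale x v + vscale y w)"
    by (simp add: finite_UNIV_inj_surj)
  then have "u \<in> range (\<lambda>(x, y). vscale x v + vscale y w)" by simp
  then show "\<exists>x y. u = vscale x v + vscale y w" by (simp add: image_iff)
qed

text \<open>For \<open>z\<close> outside \<open>K\<close> the elements \<open>a + b * z\<close> with
  \<open>a\<close>, \<open>b\<close> in \<open>K\<close> are pairwise distinct, since a coincidence
  would express \<open>z\<close> as a quotient of differences of elements of
  \<open>K\<close>.\<close>

lemma proper_subfield_card:
  fixes K :: "'a::{field,finite} set"
  assumes diff: "\<And>a b. a \<in> K \<Longrightarrow> b \<in> K \<Longrightarrow> a - b \<in> K"
    and divide: "\<And>a b. a \<in> K \<Longrightarrow> b \<in> K \<Longrightarrow> b \<noteq> 0 \<Longrightarrow> a / b \<in> K"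
    and "K \<noteq> UNIV"
  shows "card K ^ 2 \<le> CARD('a)"
proof -
  obtain z where z: "z \<notin> K" using assms(3) by blast
  have "inj_on (\<lambda>(a, b). a + b * z) (K \<times> K)"
  proof (rule inj_onI, clarify)
    fix a b a' b' assume *: "a \<in> K" "b \<in> K" "a' \<in> K" "b' \<in> K" "a + b * z = a' + b' * z"
    have "b = b'"
    proof (rule ccontr)
      assume "b \<noteq> b'"
      then have "z = (a' - a) / (b - b')"
        using *(5) by (simp add: field_simps)
      then show False using * z diff divide \<open>b \<noteq> b'\<close> by simp
    qed
    then show "a = a' \<and> b = b'" using * by simp
  qed
  then have "card (K \<times> K) \<le> CARD('a)"
    by (rule card_inj_on_le) auto
  then show ?thesis by (simp add: card_cartesian_product power2_eq_square)
qed

text \<open>In coordinates with respect to a basis taken from two lines of \<open>G\<close>, a third line of \<open>G\<close>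
  makes \<open>\<phi>\<close> act by one additive \<open>A\<close> on both coordinates, and each further line contributes
  its slope to the subfield of all \<open>m\<close> for which \<open>A\<close> is multiplicative in \<open>m\<close>.\<close>

lemma additive_preserving_lines_semilinear:
  fixes \<phi> :: "'a::{field,finite} \<times> 'a \<Rightarrow> 'a \<times> 'a"
  assumes bij: "bij \<phi>" and add: "\<And>v w. \<phi> (v + w) = \<phi> v + \<phi> w"
    and G: "\<And>V. V \<in> G \<Longrightarrow> \<exists>v. v \<noteq> 0 \<and> V = line v"
    and \<phi>G: "\<And>V. V \<in> G \<Longrightarrow> \<exists>w. \<phi> ` V = line w"
    and card3: "card G \<ge> 3" and card: "(card G - 1) ^ 2 > CARD('a)"
  shows "semilinear \<phi>"
proof -
  have inj: "\<phi> x = \<phi> y \<longleftrightarrow> x = y" for x y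
    using bij by (auto dest: bij_is_inj injD)
  have \<phi>0: "\<phi> 0 = 0" using add[of 0 0] by simp
  then have \<phi>_0_iff: "\<phi> v = 0 \<longleftrightarrow> v = 0" for v using inj by metis
  have G_line: "V = line v" if "V \<in> G" "v \<in> V" "v \<noteq> 0" for V v
    using G[OF that(1)] that line_eq by metis
  have \<phi>_line: "\<phi> ` V = line (\<phi> v)" if "V \<in> G" "v \<in> V" "v \<noteq> 0" for V v
    using \<phi>G[OF that(1)] that line_eq[of "\<phi> v"] \<phi>_0_iff by (metis imageI)
  have \<phi>_scale: "\<exists>c. \<phi> (vscale x v) = vscale c (\<phi> v)" if "line v \<in> G" "v \<noteq> 0" for x v
  proof -
    have "\<phi> (vscale x v) \<in> \<phi> ` line v" by (auto simp: line_def)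
    also have "\<dots> = line (\<phi> v)" using \<phi>_line[OF that(1) line_self that(2)] .
    finally show ?thesis by (auto simp: line_def)
  qed
  obtain T where T: "T \<subseteq> G" "card T = 3" using card3 by (meson obtain_subset_with_card_n)
  then obtain V0 V1 V2 where V: "V0 \<in> G" "V1 \<in> G" "V2 \<in> G" and ne: "V0 \<noteq> V1" "V0 \<noteq> V2" "V1 \<noteq> V2"
    by (auto simp: card_3_iff)
  obtain e0 e1 where e: "e0 \<noteq> 0" "V0 = line e0" "e1 \<noteq> 0" "V1 = line e1"
    using G V by metis
  obtain e2 where e2: "e2 \<noteq> 0" "V2 = line e2" using G V by metis
  have "e1 \<notin> line e0" using e ne line_eq by metis
  then obtain x y where xy: "e2 = vscale x e0 + vscale y e1"
    using independent_decompose(1)[OF e(1,3)] by blast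
  have "x \<noteq> 0"
  proof
    assume "x = 0"
    then have "e2 \<in> line e1" using xy by (auto simp: vscale_simps line_def)
    then show False using ne e e2 line_eq by metis
  qed
  have "y \<noteq> 0"
  proof
    assume "y = 0"
    then have "e2 \<in> line e0" using xy by (auto simp: vscale_simps line_def)
    then show False using ne e e2 line_eq by metis
  qed
  \<comment> \<open>Rescaling the basis puts the third line through \<open>v0 + v1\<close>, with
    equal coordinates; this is what makes \<open>A\<close> and \<open>A'\<close> coincide
    below.\<close>
  define v0 v1 where "v0 = vscale x e0" and "v1 = vscale y e1"
  have v: "v0 \<noteq> 0" "v1 \<noteq> 0"
    using \<open>x \<noteq> 0\<close> \<open>y \<noteq> 0\<close> e by (auto simp: v0_def v1_def vscale_eq_0_iff)
  have "v0 \<in> line e0" "v1 \<in> line e1" by (auto simp: v0_def v1_def line_def)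
  then have lines: "V0 = line v0" "V1 = line v1" "V2 = line (v0 + v1)"
    using v e e2 line_eq xy unfolding v0_def v1_def by metis+
  have v01: "v1 \<notin> line v0" using lines ne v line_eq by metis
  have v2: "v0 + v1 \<noteq> 0" using e2 xy by (simp add: v0_def v1_def)
  define w0 w1 where "w0 = \<phi> v0" and "w1 = \<phi> v1"
  have w: "w0 \<noteq> 0" "w1 \<noteq> 0" using v by (auto simp: w0_def w1_def \<phi>_0_iff)
  have "w1 \<notin> line w0"
  proof -
    have "line w0 = \<phi> ` line v0"
      using \<phi>_line[OF V(1)] lines(1) line_self v by (metis w0_def)
    then show ?thesis using v01 by (auto simp: w1_def inj)
  qed
  note w_cancel = independent_decompose(2)[OF w this]
  obtain A where A: "\<And>x. \<phi> (vscale x v0) = vscale (A x) w0"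
    using \<phi>_scale[of v0] V lines v unfolding w0_def by metis
  obtain A' where A': "\<And>x. \<phi> (vscale x v1) = vscale (A' x) w1"
    using \<phi>_scale[of v1] V lines v unfolding w1_def by metis
  have "A' x = A x" for x
  proof -
    obtain c where "\<phi> (vscale x (v0 + v1)) = vscale c (\<phi> (v0 + v1))"
      using \<phi>_scale[of "v0 + v1"] V lines v2 by metis
    then have "vscale (A x) w0 + vscale (A' x) w1 = vscale c w0 + vscale c w1"
      by (simp add: vscale_simps add A A' flip: w0_def w1_def)
    then show ?thesis using w_cancel by simp
  qed
  then have \<phi>_coord: "\<phi> (vscale x v0 + vscale y v1) = vscale (A x) w0 + vscale (A y) w1" for x y
    using A A' add by simp
  have A1: "A 1 = 1"
    using A[of 1] w vscale_right_cancel[of w0 "A 1" 1] by (simp add: vscale_simps w0_def)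
  have A_add: "A (x + y) = A x + A y" for x y
    using A[of "x + y"] w by (simp add: vscale_simps(7) add A flip: vscale_right_cancel[of w0])
  have A_diff: "A (x - y) = A x - A y" for x y
    using A_add[of "x - y" y] by simp
  have A0: "A 0 = 0" using A_diff[of 0 0] by simp
  have A_inj: "inj A"
  proof (rule injI)
    fix x y assume "A x = A y"
    then have "vscale x v0 = vscale y v0" using A inj by metis
    then show "x = y" using v vscale_right_cancel by blast
  qed
  then have A_0_iff: "A x = 0 \<longleftrightarrow> x = 0" for x using A0 by (metis injD)
  define K where "K = {m. \<forall>x. A (x * m) = A x * A m}"
  \<comment> \<open>With \<open>v0\<close> and \<open>v1\<close> as axes every line except
    \<open>V1\<close> has a slope \<open>m\<close>. Dropping \<open>V1\<close> accounts for
    \<open>card G - 1\<close> in the hypothesis.\<close>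
  have "\<exists>m\<in>K. V = line (v0 + vscale m v1)" if VG: "V \<in> G - {V1}" for V
  proof -
    obtain u where u: "u \<noteq> 0" "V = line u" using G VG by blast
    obtain a b where ab: "u = vscale a v0 + vscale b v1"
      using independent_decompose(1)[OF v v01] by blast
    have "a \<noteq> 0"
    proof
      assume "a = 0"
      then have "u \<in> line v1" using ab by (auto simp: vscale_simps line_def)
      then show False using VG lines u line_eq by (metis Diff_iff singletonI)
    qed
    define m where "m = b / a"
    have "v0 + vscale m v1 = vscale (1 / a) u"
      using \<open>a \<noteq> 0\<close> by (simp add: ab vscale_simps m_def)
    then have "v0 + vscale m v1 \<in> line u" by (auto simp: line_def)
    moreover have nz: "v0 + vscale m v1 \<noteq> 0"
      using \<open>v0 + vscale m v1 = vscale (1 / a) u\<close> u \<open>a \<noteq> 0\<close> by (simp add: vscale_eq_0_iff)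
    ultimately have V: "V = line (v0 + vscale m v1)" using u line_eq by metis
    \<comment> \<open>The \<open>w0\<close> coordinate will give \<open>c = A x\<close>, and then
      the \<open>w1\<close> coordinate gives the product rule.\<close>
    have "A (x * m) = A x * A m" for x
    proof -
      obtain c where c: "\<phi> (vscale x (v0 + vscale m v1)) = vscale c (\<phi> (v0 + vscale m v1))"
        using \<phi>_scale[of "v0 + vscale m v1"] VG V nz by blast
      have "\<phi> (v0 + vscale m v1) = w0 + vscale (A m) w1"
        using \<phi>_coord[of 1 m] by (simp add: vscale_simps A1)
      moreover have "\<phi> (vscale x (v0 + vscale m v1)) = vscale (A x) w0 + vscale (A (x * m)) w1"
        using \<phi>_coord[of x "x * m"] by (simp add: vscale_simps)
      ultimately have "vscale (A x) w0 + vscale (A (x * m)) w1 = vscale c w0 + vscale (c * A m) w1"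
        using c by (simp add: vscale_simps)
      then show ?thesis using w_cancel by simp
    qed
    then show ?thesis using V by (auto simp: K_def)
  qed
  then have "G - {V1} \<subseteq> (\<lambda>m. line (v0 + vscale m v1)) ` K" by blast
  then have "card (G - {V1}) \<le> card K" by (rule surj_card_le[rotated]) simp
  then have "card G - 1 \<le> card K" using V(2) by simp
  then have "(card G - 1) ^ 2 \<le> card K ^ 2" by (rule power_mono) simp
  with card have "card K ^ 2 > CARD('a)" by (rule less_le_trans)
  moreover have "a - b \<in> K" if "a \<in> K" "b \<in> K" for a b
    using that by (simp add: K_def A_diff algebra_simps)
  moreover have "a / b \<in> K" if "a \<in> K" "b \<in> K" "b \<noteq> 0" for a b
  proof -
    \<comment> \<open>The defining property of \<open>b \<in> K\<close> is used at
      \<open>x / b\<close>.\<close>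
    have b: "A (x / b) = A x / A b" for x
    proof -
      have "A (x / b * b) = A (x / b) * A b" using that by (simp only: K_def mem_Collect_eq)
      then show ?thesis using that A_0_iff by (simp add: field_simps)
    qed
    have "A (x * a / b) = A x * A (a / b)" for x
      unfolding b using that by (simp add: K_def)
    then show ?thesis by (simp add: K_def)
  qed
  ultimately have "K = UNIV"
    using proper_subfield_card[of K] by force
  then have A_mult: "A (x * y) = A x * A y" for x y by (auto simp: K_def)
  have "bij A" using A_inj by (simp add: finite_UNIV_inj_surj bij_def)
  then have "field_automorphism A"
    using A1 A_add A_mult by (simp add: field_automorphism_def)
  moreover have "\<phi> (vscale c u) = vscale (A c) (\<phi> u)" for c u
  proof -
    obtain a b where ab: "u = vscale a v0 + vscale b v1"
      using independent_decompose(1)[OF v v01] by blast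
    show ?thesis
      using \<phi>_coord[of "c * a" "c * b"] \<phi>_coord[of a b] by (simp add: ab vscale_simps A_mult)
  qed
  ultimately show ?thesis using add by (auto simp: semilinear_def)
qed

section \<open>The subfield of order q\<close>

lemma card_Compl_finite: "card (- A) = CARD('a) - card A" for A :: "'a::finite set"
  by (simp add: Compl_eq_Diff_UNIV card_Diff_subset)

text \<open>Multiplication by \<open>x\<close> permutes the nonzero elements and so preserves their
  product.\<close>

lemma finite_field_power_order:
  fixes x :: "'a::{field,finite}"
  assumes "x \<noteq> 0"
  shows "x ^ (CARD('a) - 1) = 1"
proof -
  have "(\<Prod>y\<in>-{0}. x * y) = (\<Prod>y\<in>-{0}. y)"
    by (rule prod.reindex_bij_witness[of _ "\<lambda>y. y / x" "\<lambda>y. x * y"]) (use assms in auto)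
  then have "x ^ card (-{0::'a}) * \<Prod>(-{0}) = \<Prod>(-{0})"
    by (simp add: prod.distrib)
  then show ?thesis by (simp add: card_Compl_finite)
qed

text \<open>Shifting by 1 permutes the field, so comparing sums over all elements shows that the
  characteristic divides the order; hence it is the prime underlying \<open>q\<close>. This is what
  makes powers of \<open>q\<close> additive exponents.\<close>

lemma primepow_eq_CHAR_power:
  fixes q t :: nat
  assumes "primepow q" and card: "CARD('a::{field,finite}) = q ^ t"
  obtains n where "q = CHAR('a) ^ n" and "prime CHAR('a)"
proof -
  have pr: "prime CHAR('a)"
    by (rule prime_CHAR_semidom) (simp add: finite_imp_CHAR_pos)
  obtain p n where pn: "prime p" "q = p ^ n"
    using assms(1) by (auto simp: primepow_def)
  have "(\<Sum>x\<in>UNIV. x + 1 :: 'a) = (\<Sum>x\<in>UNIV. x)"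
    by (rule sum.reindex_bij_witness[of _ "\<lambda>x. x - 1" "\<lambda>x. x + 1"]) auto
  then have "of_nat CARD('a) = (0 :: 'a)" by (simp add: sum.distrib)
  then have "CHAR('a) dvd CARD('a)" by (simp only: of_nat_eq_0_iff_char_dvd)
  then have "CHAR('a) dvd (p ^ n) ^ t" by (simp only: card pn)
  then have "CHAR('a) dvd p"
    using pr by (metis prime_dvd_power)
  then have "CHAR('a) = p" using pn pr by (simp add: primes_dvd_imp_eq)
  then show thesis using that pn pr by blast
qed

lemma card_eq_sum_fibers:
  assumes "finite A"
  shows "card A = (\<Sum>y\<in>g ` A. card {x\<in>A. g x = y})"
  using sum.image_gen[OF assms, of "\<lambda>_. 1::nat" g] by simp

text \<open>The norm \<open>x \<mapsto> x ^ (1 + q + \<dots> + q ^ (t - 1))\<close> takes nonzero values in the subfield, and its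
  fibres are bounded by its degree.\<close>

lemma Fq_card_ge:
  fixes q t :: nat
  assumes q: "q > 1" and card: "CARD('a::{field,finite}) = q ^ t"
  shows "card (Fq q - {0 :: 'a}) \<ge> q - 1"
proof -
  \<comment> \<open>Two distinct elements exclude \<open>t = 0\<close>, so the sum \<open>N\<close>
    below is not empty.\<close>
  have "card {0, 1 :: 'a} \<le> CARD('a)" by (rule card_mono) auto
  then have "t > 0" using card by (cases t) auto
  define N where "N = (\<Sum>i<t. q ^ i)"
  have "q ^ 0 \<le> N"
    unfolding N_def using \<open>t > 0\<close> by (intro member_le_sum) auto
  then have N: "N > 0" by simp
  \<comment> \<open>The geometric series; it makes \<open>(q - 1) * N\<close> the number of nonzero
    elements.\<close>
  have "(q - 1) * (\<Sum>i<s. q ^ i) + 1 = q ^ s" for s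
  proof (induction s)
    case (Suc s)
    have "(q - 1) * (\<Sum>i<Suc s. q ^ i) + 1 = (q - 1) * q ^ s + q ^ s"
      using Suc by (simp add: distrib_left)
    also have "\<dots> = (q - 1 + 1) * q ^ s" by (simp only: distrib_right mult_1)
    finally show ?case using q by simp
  qed simp
  then have NC: "(q - 1) * N = CARD('a) - 1"
    unfolding N_def card by (metis add_diff_cancel_right')
  define g :: "'a \<Rightarrow> 'a" where "g x = x ^ N" for x
  have img: "g ` (-{0}) \<subseteq> Fq q - {0}"
  proof -
    have "(x ^ N) ^ q = x ^ N" if "x \<noteq> 0" for x :: 'a
    proof -
      have "(x ^ N) ^ q = x ^ N * x ^ ((q - 1) * N)"
        using q by (simp add: algebra_simps flip: power_mult power_add)
      then show ?thesis using finite_field_power_order[OF that] NC by simp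
    qed
    then show ?thesis by (auto simp: g_def Fq_def)
  qed
  have fib: "card {x \<in> -{0}. g x = c} \<le> N" for c
  proof -
    let ?p = "monom 1 N - [:c:]"
    have "coeff ?p N = 1" using N by (simp add: coeff_pCons split: nat.splits)
    then have "?p \<noteq> 0" by (metis coeff_0 zero_neq_one)
    then have "card {x. poly ?p x = 0} \<le> degree ?p" by (rule card_poly_roots_bound)
    also have "\<dots> \<le> N" by (intro degree_diff_le) (auto simp: degree_monom_le)
    finally have "card {x. poly ?p x = 0} \<le> N" .
    moreover have "card {x \<in> -{0}. g x = c} \<le> card {x. poly ?p x = 0}"
      by (rule card_mono) (auto simp: g_def poly_monom)
    ultimately show ?thesis by simp
  qed
  \<comment> \<open>The nonzero elements are counted by fibres of the norm, and the common factor
    \<open>N\<close> cancels.\<close>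
  have "(q - 1) * N = card (-{0::'a})" using NC by (simp add: card_Compl_finite)
  also have "\<dots> = (\<Sum>y\<in>g ` (-{0}). card {x \<in> -{0}. g x = y})"
    by (rule card_eq_sum_fibers) simp
  also have "\<dots> \<le> card (g ` (-{0})) * N"
    using sum_bounded_above[of "g ` (-{0})" "\<lambda>y. card {x \<in> -{0}. g x = y}" N] fib by simp
  also have "\<dots> \<le> card (Fq q - {0 :: 'a}) * N"
    using img by (intro mult_right_mono card_mono) auto
  finally show ?thesis using N by simp
qed

text \<open>Each fibre of \<open>g\<close> contains all multiples of one of its points by nonzero
  elements of \<open>Fq q\<close>, hence at least \<open>q - 1\<close> elements. This will bound
  both the number of slopes in \<open>L_set f\<close> and the number of sets
  \<open>h U\<^sub>f\<close>.\<close>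

lemma Fq_invariant_image_card:
  fixes g :: "'a::{field,finite} \<Rightarrow> 'b"
  assumes "q > 1" and "CARD('a) = q ^ t"
    and inv: "\<And>c x. c \<in> Fq q \<Longrightarrow> c \<noteq> 0 \<Longrightarrow> x \<noteq> 0 \<Longrightarrow> g (c * x) = g x"
  shows "card (g ` (-{0})) * (q - 1) \<le> CARD('a) - 1"
proof -
  have "q - 1 \<le> card {x \<in> -{0}. g x = y}" if y: "y \<in> g ` (-{0})" for y
  proof -
    obtain x where x: "x \<noteq> 0" "y = g x" using y by auto
    have "card (Fq q - {0 :: 'a}) = card ((\<lambda>c. c * x) ` (Fq q - {0}))"
      using x(1) by (intro card_image[symmetric] inj_onI) auto
    also have "\<dots> \<le> card {x \<in> -{0}. g x = y}"
      using x inv by (intro card_mono) auto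
    finally show ?thesis using Fq_card_ge[OF assms(1,2)] by simp
  qed
  then have "card (g ` (-{0})) * (q - 1) \<le> (\<Sum>y\<in>g ` (-{0}). card {x \<in> -{0}. g x = y})"
    using sum_bounded_below[of "g ` (-{0})" "q - 1" "\<lambda>y. card {x \<in> -{0}. g x = y}"] by simp
  also have "\<dots> = card (-{0::'a})"
    by (rule card_eq_sum_fibers[symmetric]) simp
  finally show ?thesis by (simp add: card_Compl_finite)
qed

section \<open>The spread of a scattered polynomial\<close>

lemma span_slope_mem_iff: "v \<in> V2.span {(1, m)} \<longleftrightarrow> snd v = m * fst v"
  by (auto simp: V2.span_singleton vscale_def image_iff prod_eq_iff mult.commute)

lemma span_eq_line: "V2.span {v} = line v"
  by (auto simp: V2.span_singleton line_def)

lemma vertical_eq_line: "{0} \<times> UNIV = line (0, 1)"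
  by (auto simp: line_def vscale_def)

lemma U_mem_iff:
  assumes "h \<noteq> 0"
  shows "v \<in> vscale h ` U_set f \<longleftrightarrow> snd v = h * poly f (fst v / h)"
proof
  assume "snd v = h * poly f (fst v / h)"
  then have "v = vscale h (fst v / h, poly f (fst v / h))"
    using assms by (simp add: vscale_def prod_eq_iff)
  then show "v \<in> vscale h ` U_set f" unfolding U_set_def by blast
qed (use assms in \<open>auto simp: U_set_def vscale_def\<close>)

text \<open>The spread is split into lines over the big field and the sets in
  \<open>U_components\<close>; \<open>U_not_line\<close> will show that the two kinds do not overlap
  when \<open>f\<close> is scattered.\<close>

definition linear_components :: "'a::field poly \<Rightarrow> ('a \<times> 'a) set set" where
  "linear_components f = (\<lambda>m. V2.span {(1, m)}) ` (- L_set f) \<union> {{0} \<times> UNIV}"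

definition U_components :: "'a::field poly \<Rightarrow> ('a \<times> 'a) set set" where
  "U_components f = (\<lambda>h. vscale h ` U_set f) ` (- {0})"

lemma spread_of_eq: "spread_of f = linear_components f \<union> U_components f"
  unfolding spread_of_def linear_components_def U_components_def by blast

lemma linear_components_line:
  fixes f :: "'a::field poly"
  assumes "V \<in> linear_components f"
  shows "\<exists>v. v \<noteq> 0 \<and> V = line v"
proof -
  have "(1 :: 'a, m) \<noteq> 0" "(0 :: 'a, 1 :: 'a) \<noteq> 0" for m :: 'a
    by (simp_all add: zero_prod_def)
  then show ?thesis
    using assms unfolding linear_components_def span_eq_line vertical_eq_line by blast
qed

text \<open>The assumptions on one polynomial, to be interpreted for \<open>f\<close> and for
  \<open>f'\<close> with the same \<open>q\<close> and \<open>t\<close>.\<close>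

locale scattered_poly =
  fixes f :: "'a::{field,finite} poly" and q t :: nat
  assumes q: "primepow q" "q > 3" and t: "t > 1"
    and card: "CARD('a) = q ^ t"
    and linearized: "linearized q f" and scattered: "scattered q f"
begin

text \<open>The exponent is a power of the characteristic, so the binomial theorem
  collapses.\<close>

lemma frobenius_add: "(x + y :: 'a) ^ q ^ i = x ^ q ^ i + y ^ q ^ i"
proof -
  obtain n where n: "q = CHAR('a) ^ n" "prime CHAR('a)"
    using primepow_eq_CHAR_power[OF q(1) card] .
  show ?thesis
    by (rule freshmans_dream'[of _ "n * i"]) (simp_all add: n power_mult)
qed

lemma poly_add: "poly f (x + y) = poly f x + poly f y"
  using linearized by (auto simp: linearized_def poly_sum poly_monom frobenius_add distrib_left sum.distrib)

lemma poly_diff: "poly f (x - y) = poly f x - poly f y"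
  using poly_add[of "x - y" y] by simp

lemma poly_0: "poly f 0 = 0"
  using poly_diff[of 0 0] by simp

lemma Fq_power: "c \<in> Fq q \<Longrightarrow> c ^ q ^ i = c"
  by (induction i) (simp_all add: Fq_def power_mult)

lemma poly_Fq_mult: "c \<in> Fq q \<Longrightarrow> poly f (c * x) = c * poly f x"
  using linearized
  by (auto simp: linearized_def poly_sum poly_monom power_mult_distrib Fq_power sum_distrib_left mult_ac)

text \<open>Additivity of the \<open>q\<close>-th power at \<open>c\<close> and \<open>- c\<close>
  avoids a distinction by the parity of \<open>q\<close>.\<close>

lemma Fq_uminus: "(c :: 'a) \<in> Fq q \<Longrightarrow> - c \<in> Fq q"
proof -
  assume "c \<in> Fq q"
  moreover have "c ^ q + (- c) ^ q = 0"
    using frobenius_add[of c "- c" 1] q by (simp add: power_0_left)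
  ultimately show ?thesis by (simp add: Fq_def eq_neg_iff_add_eq_0 add.commute)
qed

lemma Fq_divide: "(c :: 'a) \<in> Fq q \<Longrightarrow> d \<in> Fq q \<Longrightarrow> c / d \<in> Fq q"
  by (simp add: Fq_def power_divide)

text \<open>Equal quotients give a nontrivial relation \<open>a * x + b * y = 0\<close> over
  \<open>Fq q\<close>; it can be solved for \<open>y\<close> since \<open>b = 0\<close> would force
  \<open>a = 0\<close>.\<close>

lemma scattered_quotient:
  assumes "x \<noteq> 0" "y \<noteq> 0" "poly f x / x = poly f y / y"
  obtains c where "c \<in> Fq q" "y = c * x"
proof -
  have "y * poly f x - x * poly f y = 0"
    using assms by (simp add: field_simps)
  then have "lin_dependent_Fq q x y" using scattered by (simp add: scattered_def)
  then obtain a b where ab: "a \<in> Fq q" "b \<in> Fq q" "a \<noteq> 0 \<or> b \<noteq> 0" "a * x + b * y = 0"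
    by (auto simp: lin_dependent_Fq_def)
  have "b \<noteq> 0" using ab assms by auto
  then have "y = (- a / b) * x" using ab(4) by (simp add: field_simps eq_neg_iff_add_eq_0 add_ac)
  then show thesis using that ab Fq_divide Fq_uminus by blast
qed

text \<open>\<open>f\<close> commutes with scalars from \<open>Fq q\<close>, so \<open>c\<close>
  cancels in the graph description of \<open>U_mem_iff\<close>.\<close>

lemma U_scale_Fq:
  assumes "c \<in> Fq q" "c \<noteq> 0" "h \<noteq> 0"
  shows "vscale (c * h) ` U_set f = vscale h ` U_set f"
proof -
  have "c * h * poly f (x / (c * h)) = h * poly f (x / h)" for x
  proof -
    have "poly f (x / h) = poly f (c * (x / (c * h)))" using assms by simp
    also have "\<dots> = c * poly f (x / (c * h))" using poly_Fq_mult assms(1) by blast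
    finally show ?thesis by simp
  qed
  then show ?thesis using assms by (auto simp add: set_eq_iff U_mem_iff simp del: mem_Sigma_iff)
qed

text \<open>The slope of a nonzero vector decides which kind of member can contain it, so members of
  different kinds share only zero.\<close>

lemma component_cases:
  assumes "V \<in> spread_of f" "v \<in> V" "v \<noteq> 0"
  shows "fst v = 0 \<and> V = {0} \<times> UNIV \<or>
    fst v \<noteq> 0 \<and> snd v / fst v \<notin> L_set f \<and> V = V2.span {(1, snd v / fst v)} \<or>
    fst v \<noteq> 0 \<and> snd v / fst v \<in> L_set f \<and> (\<exists>h. h \<noteq> 0 \<and> V = vscale h ` U_set f)"
proof -
  consider m where "m \<notin> L_set f" "V = V2.span {(1, m)}"
    | h where "h \<noteq> 0" "V = vscale h ` U_set f" | "V = {0} \<times> UNIV"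
    using assms(1) unfolding spread_of_def by blast
  then show ?thesis
  proof cases
    case 1
    then have "snd v = m * fst v" using assms(2) span_slope_mem_iff by blast
    then have "fst v \<noteq> 0" using assms(3) by (auto simp: prod_eq_iff)
    then show ?thesis using 1 \<open>snd v = m * fst v\<close> by simp
  next
    case 2
    then have *: "snd v = h * poly f (fst v / h)" using assms(2) U_mem_iff by blast
    then have "fst v \<noteq> 0" using assms(3) poly_0 by (auto simp: prod_eq_iff)
    moreover have "snd v / fst v = poly f (fst v / h) / (fst v / h)"
      using * \<open>h \<noteq> 0\<close> by simp
    then have "snd v / fst v \<in> L_set f"
      using \<open>fst v \<noteq> 0\<close> \<open>h \<noteq> 0\<close> unfolding L_set_def
      by (metis (mono_tags, lifting) divide_eq_0_iff mem_Collect_eq)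
    ultimately show ?thesis using 2 by blast
  next
    case 3
    then show ?thesis using assms(2) by auto
  qed
qed

text \<open>After \<open>component_cases\<close> only two sets \<open>h U\<^sub>f\<close> and
  \<open>k U\<^sub>f\<close> need work: a common nonzero vector gives two arguments of
  \<open>f\<close> with the same quotient, so \<open>h\<close> and \<open>k\<close> differ by a
  factor in \<open>Fq q\<close>.\<close>

lemma spread_meet:
  assumes "V \<in> spread_of f" "W \<in> spread_of f" "v \<in> V" "v \<in> W" "v \<noteq> 0"
  shows "V = W"
proof -
  have "vscale h ` U_set f = vscale k ` U_set f"
    if "v \<in> vscale h ` U_set f" "v \<in> vscale k ` U_set f" "h \<noteq> 0" "k \<noteq> 0" "fst v \<noteq> 0" for h k
  proof -
    let ?x = "fst v / h" and ?y = "fst v / k"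
    have "poly f ?x / ?x = poly f ?y / ?y"
      using that by (simp add: U_mem_iff field_simps)
    then obtain c where c: "c \<in> Fq q" "?y = c * ?x"
      using scattered_quotient[of ?x ?y] \<open>fst v \<noteq> 0\<close> \<open>h \<noteq> 0\<close> \<open>k \<noteq> 0\<close> by auto
    then have "h = c * k" "c \<noteq> 0" using that by (auto simp: field_simps)
    then show ?thesis using U_scale_Fq[OF c(1) _ \<open>k \<noteq> 0\<close>] by simp
  qed
  then show ?thesis
    using component_cases[OF assms(1,3,5)] component_cases[OF assms(2,4,5)] assms(3,4) by blast
qed

text \<open>Every member other than the vertical line is the graph of a function on the
  field.\<close>

lemma component_card:
  assumes "V \<in> spread_of f"
  shows "card V = CARD('a)"
proof -
  have "card (range (\<lambda>x. (x, g x))) = CARD('a)" for g :: "'a \<Rightarrow> 'a"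
    by (intro card_image inj_onI) auto
  moreover have "V2.span {(1, m)} = range (\<lambda>x. (x, m * x))" for m :: 'a
    by (auto simp: span_slope_mem_iff set_eq_iff image_iff)
  moreover have "vscale h ` U_set f = range (\<lambda>x. (x, h * poly f (x / h)))" if "h \<noteq> 0" for h
    using that by (auto simp: U_mem_iff set_eq_iff simp del: mem_Sigma_iff)
  ultimately show ?thesis
    using assms unfolding spread_of_def by (auto simp: card_cartesian_product)
qed

lemma component_diff:
  assumes "V \<in> spread_of f" "v \<in> V" "w \<in> V"
  shows "v - w \<in> V"
proof -
  consider m where "V = V2.span {(1, m)}" | h where "h \<noteq> 0" "V = vscale h ` U_set f" | "V = {0} \<times> UNIV"
    using assms(1) unfolding spread_of_def by blast
  then show ?thesis
  proof cases
    case 2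
    then have "snd v = h * poly f (fst v / h)" "snd w = h * poly f (fst w / h)"
      using assms U_mem_iff by blast+
    then have "snd (v - w) = h * poly f (fst (v - w) / h)"
      by (simp add: right_diff_distrib diff_divide_distrib poly_diff)
    then show ?thesis using 2 U_mem_iff by blast
  qed (use assms in \<open>auto simp: V2.span_diff mem_Times_iff\<close>)
qed

text \<open>The smallest case is \<open>q = 4\<close>, \<open>t = 2\<close>.\<close>

lemma card_ge: "CARD('a) \<ge> 16"
proof -
  have "4 ^ 2 \<le> q ^ 2" using q by (intro power_mono) auto
  also have "\<dots> \<le> q ^ t" using q t by (intro power_increasing) auto
  finally show ?thesis by (simp add: card)
qed

sublocale planar_spread "spread_of f"
proof
  show zero: "0 \<in> V" if "V \<in> spread_of f" for V
    using that poly_0 unfolding spread_of_def by (auto simp: span_slope_mem_iff U_mem_iff zero_prod_def)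
  show "x - y \<in> V" if "V \<in> spread_of f" "x \<in> V" "y \<in> V" for V x y
    using that by (rule component_diff)
  show "V \<noteq> UNIV" if "V \<in> spread_of f" for V
    using component_card[OF that] card_ge by (auto simp: card_prod)
  show "\<exists>V\<in>spread_of f. x \<in> V" for x
  proof -
    consider "fst x = 0" | "fst x \<noteq> 0" "snd x / fst x \<notin> L_set f"
      | z where "fst x \<noteq> 0" "z \<noteq> 0" "snd x / fst x = poly f z / z"
      unfolding L_set_def by blast
    then show ?thesis
    proof cases
      case 1
      then have "x \<in> {0} \<times> UNIV" by (simp add: mem_Times_iff)
      then show ?thesis unfolding spread_of_def by blast
    next
      case 2
      then have "x \<in> V2.span {(1, snd x / fst x)}" by (simp add: span_slope_mem_iff)
      then show ?thesis using 2 unfolding spread_of_def by blast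
    next
      case 3
      \<comment> \<open>The scalar \<open>fst x / z\<close> is the one that carries
        \<open>(z, poly f z)\<close> to \<open>x\<close>.\<close>
      then have "fst x / z \<noteq> 0" by simp
      moreover from 3 have "x \<in> vscale (fst x / z) ` U_set f"
        by (simp add: U_mem_iff field_simps)
      ultimately show ?thesis unfolding spread_of_def by blast
    qed
  qed
  show "V = W" if "V \<in> spread_of f" "W \<in> spread_of f" "x \<in> V" "x \<in> W" "x \<noteq> 0" for V W x
    using that by (rule spread_meet)
  \<comment> \<open>Addition is injective on \<open>V \<times> W\<close>, which has as many elements
    as the whole plane, hence it is onto.\<close>
  show "\<exists>v\<in>V. \<exists>w\<in>W. x = v + w" if V: "V \<in> spread_of f" "W \<in> spread_of f" "V \<noteq> W" for V W x
  proof -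
    have "inj_on (\<lambda>(v, w). v + w) (V \<times> W)"
    proof (rule inj_onI, clarify)
      fix a b c d e g h k :: 'a
      assume *: "(a, b) \<in> V" "(c, d) \<in> W" "(e, g) \<in> V" "(h, k) \<in> W" "(a, b) + (c, d) = (e, g) + (h, k)"
      have "(a, b) - (e, g) \<in> V" using component_diff V * by blast
      moreover have "(h, k) - (c, d) \<in> W" using component_diff V * by blast
      moreover have "(a, b) - (e, g) = (h, k) - (c, d)" using *(5) by (simp add: algebra_simps)
      ultimately have "(a, b) - (e, g) = 0" using spread_meet V by metis
      then show "((a, b) = (e, g)) \<and> (c, d) = (h, k)" using *(5) by (simp add: zero_prod_def)
    qed
    then have "card ((\<lambda>(v, w). v + w) ` (V \<times> W)) = CARD('a \<times> 'a)"
      by (simp add: card_image card_cartesian_product component_card V card_prod)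
    then have "(\<lambda>(v, w). v + w) ` (V \<times> W) = UNIV"
      by (intro card_subset_eq) auto
    then have "x \<in> (\<lambda>(v, w). v + w) ` (V \<times> W)" by simp
    then show ?thesis by auto
  qed
qed

section \<open>Counting the members of each kind\<close>

lemma L_set_card: "card (L_set f) * (q - 1) \<le> CARD('a) - 1"
proof -
  have "L_set f = (\<lambda>x. poly f x / x) ` (- {0})" by (auto simp: L_set_def)
  moreover have "card ((\<lambda>x. poly f x / x) ` (- {0})) * (q - 1) \<le> CARD('a) - 1"
    using q card by (intro Fq_invariant_image_card[of q t]) (auto simp: poly_Fq_mult)
  ultimately show ?thesis by simp
qed

lemma U_components_card: "card (U_components f) * (q - 1) \<le> CARD('a) - 1"
  unfolding U_components_def
  using q card by (intro Fq_invariant_image_card[of q t]) (auto simp: U_scale_Fq)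

text \<open>Distinct slopes give distinct lines; the summand 1 is the vertical line.\<close>

lemma linear_components_card: "card (linear_components f) = CARD('a) - card (L_set f) + 1"
proof -
  have "inj_on (\<lambda>m. V2.span {(1, m)}) (- L_set f)"
  proof (rule inj_onI)
    fix m m' :: 'a assume "V2.span {(1, m)} = V2.span {(1, m')}"
    then have "(1, m) \<in> V2.span {(1, m')}" by (metis V2.span_base singletonI)
    then show "m = m'" by (simp add: span_slope_mem_iff)
  qed
  moreover have "{0} \<times> UNIV \<notin> (\<lambda>m. V2.span {(1, m)}) ` (- L_set f)"
  proof
    assume "{0} \<times> UNIV \<in> (\<lambda>m. V2.span {(1, m)}) ` (- L_set f)"
    then obtain m where "{0} \<times> UNIV = V2.span {(1, m :: 'a)}" by auto
    then have "(0, 1) \<in> V2.span {(1, m)}" by auto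
    then show False by (simp add: span_slope_mem_iff)
  qed
  ultimately show ?thesis
    by (simp add: linear_components_def card_image card_Compl_finite)
qed

text \<open>On a line \<open>f\<close> would be multiplication by \<open>poly f 1\<close>. All
  quotients would then agree, and scatteredness would put the whole field into \<open>Fq q\<close>,
  which has at most \<open>q < q ^ t\<close> elements as a set of roots of a polynomial of degree
  \<open>q\<close>.\<close>

lemma U_not_line:
  assumes "h \<noteq> 0"
  shows "vscale h ` U_set f \<noteq> line v"
proof
  assume eq: "vscale h ` U_set f = line v"
  have "(h, h * poly f 1) \<in> vscale h ` U_set f" using assms by (simp add: U_mem_iff)
  then have "line v = line (h, h * poly f 1)"
    using eq assms line_eq by (metis fst_conv fst_zero)
  then have mem: "vscale c (h, h * poly f 1) \<in> vscale h ` U_set f" for c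
    unfolding eq line_def by blast
  have "UNIV \<subseteq> (Fq q :: 'a set)"
  proof
    fix c :: 'a
    have "c * (h * poly f 1) = h * poly f c"
      using mem[of c] unfolding U_mem_iff[OF assms] using assms by (simp add: vscale_def)
    then have "poly f c = c * poly f 1" using assms by simp
    then show "c \<in> Fq q"
      using scattered_quotient[of 1 c] q by (cases "c = 0") (auto simp: Fq_def power_0_left)
  qed
  then have "(Fq q :: 'a set) = UNIV" by blast
  then have "CARD('a) = card (Fq q :: 'a set)" by simp
  also have "\<dots> \<le> q"
  proof -
    let ?p = "monom 1 q - [:0, 1 :: 'a:]"
    have "coeff ?p q = 1" using q by (simp add: coeff_pCons split: nat.splits)
    then have "?p \<noteq> 0" by (metis coeff_0 zero_neq_one)
    then have "card {x. poly ?p x = 0} \<le> degree ?p" by (rule card_poly_roots_bound)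
    also have "\<dots> \<le> q" using q by (intro degree_diff_le) (auto simp: degree_monom_le)
    finally show ?thesis by (simp add: Fq_def poly_monom)
  qed
  finally have "q ^ t \<le> q ^ 1" by (simp add: card)
  then show False using q t power_le_imp_le_exp[of q t 1] by simp
qed

end

section \<open>Semilinear maps and spreads\<close>

lemma field_automorphism_nonzero:
  assumes "field_automorphism \<sigma>" "c \<noteq> 0"
  shows "\<sigma> c \<noteq> 0"
proof -
  have "\<sigma> c * \<sigma> (1 / c) = \<sigma> (c * (1 / c))"
    using assms(1) unfolding field_automorphism_def by metis
  also have "\<dots> = 1" using assms by (simp add: field_automorphism_def)
  finally have "\<sigma> c * \<sigma> (1 / c) = 1" .
  then show ?thesis by auto
qed

section \<open>The group of bijective semilinear maps\<close>

lemma GammaL2_bij: "\<phi> \<in> GammaL2 \<Longrightarrow> bij \<phi>"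
  by (simp add: GammaL2_def)

lemma GammaL2_add: "\<phi> \<in> GammaL2 \<Longrightarrow> \<phi> (v + w) = \<phi> v + \<phi> w"
  unfolding GammaL2_def semilinear_def by blast

lemma GammaL2_scale:
  assumes "\<phi> \<in> GammaL2"
  obtains \<sigma> where "field_automorphism \<sigma>" "\<And>c v. \<phi> (vscale c v) = vscale (\<sigma> c) (\<phi> v)"
  using assms by (auto simp: GammaL2_def semilinear_def)

lemma image_vscale_semilinear:
  assumes "\<And>c v. \<phi> (vscale c v) = vscale (\<sigma> c) (\<phi> v)"
  shows "\<phi> ` vscale c ` S = vscale (\<sigma> c) ` \<phi> ` S"
  using assms by (auto simp: image_image)

lemma GammaL2_line:
  assumes "\<phi> \<in> GammaL2"
  shows "\<phi> ` line v = line (\<phi> v)"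
proof -
  obtain \<sigma> where \<sigma>: "field_automorphism \<sigma>" "\<And>c v. \<phi> (vscale c v) = vscale (\<sigma> c) (\<phi> v)"
    using GammaL2_scale[OF assms] by blast
  have "\<phi> ` line v = (\<lambda>c. vscale c (\<phi> v)) ` range \<sigma>"
    by (simp add: line_def image_image \<sigma>(2))
  also have "range \<sigma> = UNIV" using \<sigma>(1) by (simp add: field_automorphism_def bij_is_surj)
  finally show ?thesis by (simp add: line_def)
qed

lemma id_in_GammaL2: "id \<in> GammaL2"
  by (auto simp: GammaL2_def semilinear_def field_automorphism_def intro!: exI[of _ id])

lemma vscale_in_GammaL2:
  assumes "c \<noteq> 0"
  shows "vscale c \<in> GammaL2"
proof -
  have "bij (vscale c)"
    by (rule bij_betw_byWitness[of _ "vscale (1 / c)"]) (use assms in \<open>auto simp: vscale_simps\<close>)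
  moreover have "vscale c (v + w) = vscale c v + vscale c w"
    "vscale c (vscale d v) = vscale (id d) (vscale c v)" for d v w
    by (simp_all add: vscale_simps mult.commute)
  moreover have "field_automorphism id" by (simp add: field_automorphism_def)
  ultimately show ?thesis
    unfolding GammaL2_def semilinear_def by blast
qed

lemma comp_in_GammaL2:
  assumes "\<phi> \<in> GammaL2" "\<psi> \<in> GammaL2"
  shows "\<phi> \<circ> \<psi> \<in> GammaL2"
proof -
  obtain \<sigma> where \<sigma>: "field_automorphism \<sigma>" "\<And>c v. \<phi> (vscale c v) = vscale (\<sigma> c) (\<phi> v)"
    using GammaL2_scale[OF assms(1)] by blast
  obtain \<tau> where \<tau>: "field_automorphism \<tau>" "\<And>c v. \<psi> (vscale c v) = vscale (\<tau> c) (\<psi> v)"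
    using GammaL2_scale[OF assms(2)] by blast
  have "field_automorphism (\<sigma> \<circ> \<tau>)"
    using \<sigma>(1) \<tau>(1) unfolding field_automorphism_def by (auto intro: bij_comp)
  moreover have "(\<phi> \<circ> \<psi>) (vscale c v) = vscale ((\<sigma> \<circ> \<tau>) c) ((\<phi> \<circ> \<psi>) v)" for c v
    by (simp add: \<sigma>(2) \<tau>(2))
  moreover have "bij (\<phi> \<circ> \<psi>)"
    using assms by (intro bij_comp) (auto simp: GammaL2_def)
  moreover have "(\<phi> \<circ> \<psi>) (v + w) = (\<phi> \<circ> \<psi>) v + (\<phi> \<circ> \<psi>) w" for v w
    by (simp add: GammaL2_add assms)
  ultimately show ?thesis unfolding GammaL2_def semilinear_def by blast
qed

lemma inv_in_GammaL2:
  assumes "\<phi> \<in> GammaL2"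
  shows "inv \<phi> \<in> GammaL2"
proof -
  obtain \<sigma> where \<sigma>: "field_automorphism \<sigma>" "\<And>c v. \<phi> (vscale c v) = vscale (\<sigma> c) (\<phi> v)"
    using GammaL2_scale[OF assms] by blast
  have bij: "bij \<phi>" and add: "\<And>v w. \<phi> (v + w) = \<phi> v + \<phi> w"
    using GammaL2_bij[OF assms] GammaL2_add[OF assms] by auto
  have eqI: "inv \<phi> x = y" if "x = \<phi> y" for x y
    using that bij by (simp add: bij_is_inj)
  have f: "\<phi> (inv \<phi> x) = x" for x
    using bij by (simp add: bij_is_surj surj_f_inv_f)
  have bij\<sigma>: "bij \<sigma>" using \<sigma>(1) by (simp add: field_automorphism_def)
  have \<sigma>_eqI: "inv \<sigma> x = y" if "x = \<sigma> y" for x y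
    using that bij\<sigma> by (simp add: bij_is_inj)
  have \<sigma>_f: "\<sigma> (inv \<sigma> x) = x" for x
    using bij\<sigma> by (simp add: bij_is_surj surj_f_inv_f)
  have "inv \<sigma> 1 = 1" "inv \<sigma> (x + y) = inv \<sigma> x + inv \<sigma> y" "inv \<sigma> (x * y) = inv \<sigma> x * inv \<sigma> y" for x y
    using \<sigma>(1) by (auto intro!: \<sigma>_eqI simp: \<sigma>_f field_automorphism_def)
  then have "field_automorphism (inv \<sigma>)"
    using bij_imp_bij_inv[OF bij\<sigma>] by (simp add: field_automorphism_def)
  moreover have "inv \<phi> (vscale c v) = vscale (inv \<sigma> c) (inv \<phi> v)" for c v
    by (rule eqI) (simp add: \<sigma>(2) \<sigma>_f f)
  moreover have "inv \<phi> (v + w) = inv \<phi> v + inv \<phi> w" for v w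
    by (rule eqI) (simp add: add f)
  ultimately show ?thesis
    using bij_imp_bij_inv[OF bij] unfolding GammaL2_def semilinear_def by blast
qed

text \<open>This makes the condition symmetric, so that results about \<open>\<phi>\<close> also
  apply to its inverse with \<open>f\<close> and \<open>f'\<close> exchanged.\<close>

lemma GammaL2_inv_image_U:
  assumes \<phi>: "\<phi> \<in> GammaL2" "h' \<noteq> 0" "\<phi> ` U_set f = vscale h' ` U_set f'"
  shows "\<exists>h. h \<noteq> 0 \<and> inv \<phi> ` U_set f' = vscale h ` U_set f"
proof -
  obtain \<tau> where \<tau>: "field_automorphism \<tau>" "\<And>c v. inv \<phi> (vscale c v) = vscale (\<tau> c) (inv \<phi> v)"
    using GammaL2_scale[OF inv_in_GammaL2[OF \<phi>(1)]] by blast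
  have bij: "bij \<phi>" using \<phi>(1) by (simp add: GammaL2_def)
  have "U_set f' = vscale (1 / h') ` vscale h' ` U_set f'"
    using \<phi>(2) by (simp add: image_image vscale_simps)
  then have "inv \<phi> ` U_set f' = inv \<phi> ` vscale (1 / h') ` \<phi> ` U_set f"
    using \<phi>(3) by simp
  also have "\<dots> = vscale (\<tau> (1 / h')) ` inv \<phi> ` \<phi> ` U_set f"
    using \<tau>(2) by (rule image_vscale_semilinear)
  also have "inv \<phi> ` \<phi> ` U_set f = U_set f"
    using bij by (simp add: bij_is_inj image_inv_f_f)
  finally show ?thesis
    using field_automorphism_nonzero[OF \<tau>(1), of "1 / h'"] \<phi>(2) by auto
qed

text \<open>Multiples of \<open>U\<^sub>f\<close> go to multiples of
  \<open>U\<^sub>f\<^sub>'\<close>, and all of the latter arise since \<open>\<sigma>\<close> is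
  onto. A line of the spread goes to a line; were the member of the target spread through its
  generator a multiple of \<open>U\<^sub>f\<^sub>'\<close>, pulling back would make some
  \<open>h U\<^sub>f\<close> equal to the original line.\<close>

lemma GammaL2_image_spread:
  assumes f: "scattered_poly f q t" and f': "scattered_poly f' q t"
    and \<phi>: "\<phi> \<in> GammaL2" "h' \<noteq> 0" "\<phi> ` U_set f = vscale h' ` U_set f'"
    and V: "V \<in> spread_of f"
  shows "\<phi> ` V \<in> spread_of f'"
proof -
  interpret f: scattered_poly f q t by fact
  interpret f': scattered_poly f' q t by fact
  obtain \<sigma> where \<sigma>: "field_automorphism \<sigma>" "\<And>c v. \<phi> (vscale c v) = vscale (\<sigma> c) (\<phi> v)"
    using GammaL2_scale[OF \<phi>(1)] by blast
  have bij: "bij \<phi>" and bij\<sigma>: "bij \<sigma>"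
    using \<phi>(1) \<sigma>(1) by (auto simp: GammaL2_def field_automorphism_def)
  have U: "\<phi> ` vscale h ` U_set f = vscale (\<sigma> h * h') ` U_set f'" for h
    unfolding image_vscale_semilinear[OF \<sigma>(2)] \<phi>(3) by (simp add: image_image vscale_simps)
  show ?thesis
  proof (cases "V \<in> U_components f")
    case True
    then obtain h where h: "h \<noteq> 0" "V = vscale h ` U_set f" by (auto simp: U_components_def)
    then have "\<sigma> h * h' \<noteq> 0" using field_automorphism_nonzero[OF \<sigma>(1)] \<phi>(2) by simp
    then show ?thesis unfolding h(2) U spread_of_def by blast
  next
    case False
    then obtain v where v: "v \<noteq> 0" "V = line v"
      using V linear_components_line spread_of_eq by blast
    have "\<phi> 0 = 0" using GammaL2_add[OF \<phi>(1), of 0 0] by simp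
    then have \<phi>v: "\<phi> v \<noteq> 0" using v(1) bij by (metis bij_is_inj injD)
    obtain W where W: "W \<in> spread_of f'" "\<phi> v \<in> W" using f'.cover by blast
    have "W \<notin> U_components f'"
    proof
      assume "W \<in> U_components f'"
      then obtain k where k: "k \<noteq> 0" "W = vscale k ` U_set f'" by (auto simp: U_components_def)
      \<comment> \<open>This choice makes \<open>W\<close> the image of
        \<open>h U\<^sub>f\<close>.\<close>
      obtain h where h: "\<sigma> h = k / h'" using bij\<sigma> by (metis bij_is_surj surjD)
      then have "h \<noteq> 0" using \<sigma>(1) k(1) \<phi>(2)
        by (metis add_cancel_left_left divide_eq_0_iff field_automorphism_def)
      have "W = \<phi> ` vscale h ` U_set f" unfolding U h k(2) using \<phi>(2) by simp
      then have "v \<in> vscale h ` U_set f" using W(2) bij by (simp add: bij_is_inj inj_image_mem_iff)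
      moreover have "vscale h ` U_set f \<in> spread_of f"
        using \<open>h \<noteq> 0\<close> unfolding spread_of_def by blast
      ultimately have "vscale h ` U_set f = line v"
        using f.meet[OF _ V, of "vscale h ` U_set f" v] v line_self by metis
      then show False using f.U_not_line \<open>h \<noteq> 0\<close> by blast
    qed
    then obtain w where "w \<noteq> 0" "W = line w"
      using W(1) linear_components_line spread_of_eq by blast
    then have "W = line (\<phi> v)" using W(2) \<phi>v line_eq by metis
    then show ?thesis using W(1) v(2) GammaL2_line[OF \<phi>(1)] by simp
  qed
qed

text \<open>Members go to members under both \<open>\<phi>\<close> and its inverse, and additivity
  carries this over to cosets.\<close>

lemma GammaL2_plane_isomorphism:
  fixes f f' :: "'a::{field,finite} poly"
  assumes f: "scattered_poly f q t" and f': "scattered_poly f' q t"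
    and \<phi>: "\<phi> \<in> GammaL2" "h' \<noteq> 0" "\<phi> ` U_set f = vscale h' ` U_set f'"
  shows "plane_isomorphism (plane_of f) (plane_of f') (\<lambda>v. \<phi> v + u)"
proof -
  let ?\<alpha> = "\<lambda>v. \<phi> v + u"
  have bij: "bij \<phi>" and add: "\<And>v w. \<phi> (v + w) = \<phi> v + \<phi> w"
    using GammaL2_bij[OF \<phi>(1)] GammaL2_add[OF \<phi>(1)] by auto
  have inv_add: "\<And>v w. inv \<phi> (v + w) = inv \<phi> v + inv \<phi> w"
    using GammaL2_add[OF inv_in_GammaL2[OF \<phi>(1)]] .
  obtain h where h: "h \<noteq> 0" "inv \<phi> ` U_set f' = vscale h ` U_set f"
    using GammaL2_inv_image_U[OF \<phi>] by blast
  have "bij ((\<lambda>v. v + u) \<circ> \<phi>)"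
    using bij by (intro bij_comp bij_plus_right)
  then have bij\<alpha>: "bij ?\<alpha>" by (simp add: comp_def)
  have inv\<alpha>: "inv ?\<alpha> y = inv \<phi> (y - u)" for y
    using bij\<alpha> bij by (intro inv_f_eq) (auto simp: bij_is_inj bij_is_surj surj_f_inv_f)
  have lines: "lines (plane_of g) = {(\<lambda>v. v + w) ` V | V w. V \<in> spread_of g}" for g :: "'a poly"
    by (simp add: plane_of_def translation_plane_def)
  have "?\<alpha> ` l \<in> lines (plane_of f')" if l: "l \<in> lines (plane_of f)" for l
  proof -
    obtain V w where V: "V \<in> spread_of f" "l = (\<lambda>v. v + w) ` V" using l lines by blast
    have "?\<alpha> ` l = (\<lambda>v. v + (\<phi> w + u)) ` \<phi> ` V"
      by (simp add: V(2) image_image add add.assoc)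
    then show ?thesis
      unfolding lines using GammaL2_image_spread[OF f f' \<phi> V(1)] by blast
  qed
  moreover have "inv ?\<alpha> ` l \<in> lines (plane_of f)" if l: "l \<in> lines (plane_of f')" for l
  proof -
    obtain V w where V: "V \<in> spread_of f'" "l = (\<lambda>v. v + w) ` V" using l lines by blast
    have "inv ?\<alpha> ` l = (\<lambda>v. v + inv \<phi> (w - u)) ` inv \<phi> ` V"
      unfolding V(2) image_image inv\<alpha> by (simp add: add_diff_eq flip: inv_add)
    then show ?thesis
      unfolding lines using GammaL2_image_spread[OF f' f inv_in_GammaL2[OF \<phi>(1)] h V(1)] by blast
  qed
  ultimately show ?thesis
    using bij\<alpha> by (simp add: plane_isomorphism_def) (simp add: plane_of_def translation_plane_def)
qed

section \<open>From plane isomorphisms to semilinear maps\<close>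

lemma plane_isomorphism_GammaL2:
  fixes f f' :: "'a::{field,finite} poly"
  assumes f: "scattered_poly f q t" and f': "scattered_poly f' q t"
    and iso: "plane_isomorphism (plane_of f) (plane_of f') \<alpha>"
  shows "\<exists>u h' \<phi>. h' \<noteq> 0 \<and> \<phi> \<in> GammaL2 \<and> \<phi> ` U_set f = vscale h' ` U_set f' \<and> (\<forall>v. \<alpha> v = \<phi> v + u)"
proof -
  interpret f: scattered_poly f q t by fact
  interpret f': scattered_poly f' q t by fact
  define \<phi> where "\<phi> v = \<alpha> v - \<alpha> 0" for v
  have bij: "bij \<phi>" and comp: "\<And>V. V \<in> spread_of f \<Longrightarrow> \<phi> ` V \<in> spread_of f'"
    and add: "\<And>v w. \<phi> (v + w) = \<phi> v + \<phi> w"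
    using translation_plane_isomorphism_additive[OF f.planar_spread_axioms f'.planar_spread_axioms
        iso[unfolded plane_of_def]]
    unfolding \<phi>_def by blast+
  define G where "G = {V \<in> linear_components f. \<phi> ` V \<in> linear_components f'}"
  \<comment> \<open>Lines not in \<open>G\<close> are sent injectively to members of the form
    \<open>h U\<^sub>f\<^sub>'\<close>, so there are few of them.\<close>
  have "card (linear_components f - G) \<le> card (U_components f')"
  proof (rule card_inj_on_le)
    show "inj_on ((`) \<phi>) (linear_components f - G)"
      using bij by (metis bij_is_inj inj_image_eq_iff inj_onI)
    show "(`) \<phi> ` (linear_components f - G) \<subseteq> U_components f'"
      using comp by (auto simp: G_def spread_of_eq)
  qed simp
  then have G: "card (linear_components f) \<le> card G + card (U_components f')"
    using card_Diff_subset[of G "linear_components f"] by (auto simp: G_def)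
  \<comment> \<open>Here \<open>q > 3\<close> enters as \<open>q - 1 \<ge> 3\<close>.\<close>
  have "card (L_set f) * 3 \<le> card (L_set f) * (q - 1)" "card (U_components f') * 3 \<le> card (U_components f') * (q - 1)"
    using f.q by (auto intro: mult_left_mono)
  then have le: "card (L_set f) * 3 \<le> CARD('a) - 1" "card (U_components f') * 3 \<le> CARD('a) - 1"
    using f.L_set_card f'.U_components_card by linarith+
  \<comment> \<open>At most two thirds of \<open>CARD('a) - 1\<close> are lost, one third to the
    slopes in \<open>L_set f\<close> and one third to the lines outside \<open>G\<close>.\<close>
  have G3: "3 * (card G - 1) \<ge> CARD('a) + 2"
    using G le f.linear_components_card f.card_ge by linarith
  \<comment> \<open>Otherwise squaring \<open>G3\<close> would bound the square of
    \<open>CARD('a)\<close> by \<open>9 * CARD('a)\<close>, against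
    \<open>CARD('a) \<ge> 16\<close>.\<close>
  have "(card G - 1) ^ 2 > CARD('a)"
  proof (rule ccontr)
    assume "\<not> (card G - 1) ^ 2 > CARD('a)"
    then have "9 * (card G - 1) ^ 2 \<le> 9 * CARD('a)" by simp
    moreover have "(CARD('a) + 2) ^ 2 \<le> (3 * (card G - 1)) ^ 2"
      using G3 by (intro power_mono) auto
    moreover have "(3 * (card G - 1)) ^ 2 = 9 * (card G - 1) ^ 2"
      by (simp add: power_mult_distrib)
    moreover have "(CARD('a) + 2) ^ 2 = CARD('a) * CARD('a) + 4 * CARD('a) + 4"
      by (simp add: power2_eq_square)
    moreover have "16 * CARD('a) \<le> CARD('a) * CARD('a)"
      using f.card_ge by (rule mult_right_mono) simp
    ultimately show False by linarith
  qed
  moreover have "card G \<ge> 3" using G3 f.card_ge by linarith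
  moreover have "\<exists>v. v \<noteq> 0 \<and> V = line v" "\<exists>w. \<phi> ` V = line w" if "V \<in> G" for V
    using that linear_components_line unfolding G_def by blast+
  ultimately have "semilinear \<phi>"
    using bij add by (intro additive_preserving_lines_semilinear[of \<phi> G])
  then have \<phi>: "\<phi> \<in> GammaL2" using bij by (simp add: GammaL2_def)
  have U: "U_set f = vscale 1 ` U_set f" by (simp add: vscale_simps)
  \<comment> \<open>The inverse is semilinear too, so it would turn a line back into a line equal to
    \<open>U_set f\<close>.\<close>
  have "\<phi> ` U_set f \<notin> linear_components f'"
  proof
    assume "\<phi> ` U_set f \<in> linear_components f'"
    then obtain w where "\<phi> ` U_set f = line w" using linear_components_line by blast
    then have "inv \<phi> ` \<phi> ` U_set f = line (inv \<phi> w)"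
      using GammaL2_line[OF inv_in_GammaL2[OF \<phi>]] by simp
    then have "vscale 1 ` U_set f = line (inv \<phi> w)"
      using bij U by (simp add: bij_is_inj image_inv_f_f)
    then show False using f.U_not_line[OF one_neq_zero] by blast
  qed
  moreover have "U_set f \<in> spread_of f"
    using U unfolding spread_of_def by (metis (mono_tags, lifting) UnI1 UnI2 mem_Collect_eq zero_neq_one)
  ultimately have "\<phi> ` U_set f \<in> U_components f'"
    using comp spread_of_eq by blast
  then obtain h' where "h' \<noteq> 0" "\<phi> ` U_set f = vscale h' ` U_set f'"
    by (auto simp: U_components_def)
  moreover have "\<alpha> v = \<phi> v + \<alpha> 0" for v by (simp add: \<phi>_def)
  ultimately show ?thesis using \<phi> by blast
qed

theorem theorem4p2:
  fixes f f' :: "'a::{field,finite} poly" and q t :: nat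
  assumes "primepow q" and "q > 3" and "t > 1"
    and "CARD('a) = q ^ t"
    and "linearized q f" and "scattered q f"
    and "linearized q f'" and "scattered q f'"
  shows "(\<forall>\<alpha> :: 'a \<times> 'a \<Rightarrow> 'a \<times> 'a. bij \<alpha> \<longrightarrow>
            (plane_isomorphism (plane_of f) (plane_of f') \<alpha> \<longleftrightarrow>
             (\<exists>u h' \<phi>. h' \<noteq> 0 \<and> \<phi> \<in> GammaL2 \<and> \<phi> ` U_set f = vscale h' ` U_set f' \<and>
                       (\<forall>v. \<alpha> v = \<phi> v + u)))) \<and>
         (isomorphic_planes (plane_of f) (plane_of f') \<longleftrightarrow>
          (\<exists>W. U_set f \<in> GammaL2_orbit W \<and> U_set f' \<in> GammaL2_orbit W))"
proof -
  have f: "scattered_poly f q t" and f': "scattered_poly f' q t"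
    using assms by (simp_all add: scattered_poly_def)
  have iff: "plane_isomorphism (plane_of f) (plane_of f') \<alpha> \<longleftrightarrow>
      (\<exists>u h' \<phi>. h' \<noteq> 0 \<and> \<phi> \<in> GammaL2 \<and> \<phi> ` U_set f = vscale h' ` U_set f' \<and> (\<forall>v. \<alpha> v = \<phi> v + u))"
    (is "?iso \<longleftrightarrow> ?semi") for \<alpha>
  proof
    show ?semi if ?iso using plane_isomorphism_GammaL2[OF f f' that] .
    show ?iso if semi: ?semi
    proof -
      obtain u h' \<phi> where "h' \<noteq> 0" "\<phi> \<in> GammaL2" "\<phi> ` U_set f = vscale h' ` U_set f'"
        and \<alpha>: "\<And>v. \<alpha> v = \<phi> v + u"
        using semi by blast
      moreover have "\<alpha> = (\<lambda>v. \<phi> v + u)" using \<alpha> by (rule ext)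
      ultimately show ?thesis using GammaL2_plane_isomorphism[OF f f'] by blast
    qed
  qed
  have "isomorphic_planes (plane_of f) (plane_of f') \<longleftrightarrow>
      (\<exists>W. U_set f \<in> GammaL2_orbit W \<and> U_set f' \<in> GammaL2_orbit W)"
  proof
    assume "isomorphic_planes (plane_of f) (plane_of f')"
    then obtain h' \<phi> where \<phi>: "h' \<noteq> 0" "\<phi> \<in> GammaL2" "\<phi> ` U_set f = vscale h' ` U_set f'"
      unfolding isomorphic_planes_def iff by blast
    \<comment> \<open>Scaling by \<open>1 / h'\<close> is itself in \<open>GammaL2\<close>, so the
      factor \<open>h'\<close> is absorbed and disappears from the orbit statement.\<close>
    have "(vscale (1 / h') \<circ> \<phi>) ` U_set f = vscale (1 / h') ` \<phi> ` U_set f"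
      by (simp only: image_comp)
    then have "U_set f' = (vscale (1 / h') \<circ> \<phi>) ` U_set f"
      unfolding \<phi>(3) using \<phi>(1) by (simp add: image_image vscale_simps)
    moreover have "vscale (1 / h') \<circ> \<phi> \<in> GammaL2"
      using \<phi>(1,2) by (intro comp_in_GammaL2 vscale_in_GammaL2) simp_all
    ultimately have "U_set f' \<in> GammaL2_orbit (U_set f)"
      unfolding GammaL2_orbit_def by blast
    moreover have "U_set f = id ` U_set f" by simp
    then have "U_set f \<in> GammaL2_orbit (U_set f)"
      unfolding GammaL2_orbit_def using id_in_GammaL2 by blast
    ultimately show "\<exists>W. U_set f \<in> GammaL2_orbit W \<and> U_set f' \<in> GammaL2_orbit W" by blast
  next
    assume "\<exists>W. U_set f \<in> GammaL2_orbit W \<and> U_set f' \<in> GammaL2_orbit W"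
    then obtain W \<phi> \<psi> where \<phi>: "\<phi> \<in> GammaL2" "U_set f = \<phi> ` W" and \<psi>: "\<psi> \<in> GammaL2" "U_set f' = \<psi> ` W"
      unfolding GammaL2_orbit_def by blast
    \<comment> \<open>Passing through \<open>W\<close> gives a semilinear map between the two sets,
      and the first equivalence is used with \<open>h' = 1\<close> and \<open>u = 0\<close>.\<close>
    have "inj \<phi>" using \<phi>(1) by (simp add: GammaL2_def bij_is_inj)
    then have "(\<psi> \<circ> inv \<phi>) ` U_set f = vscale 1 ` U_set f'"
      unfolding \<phi>(2) \<psi>(2) by (simp add: image_image vscale_simps)
    moreover have "\<psi> \<circ> inv \<phi> \<in> GammaL2" using comp_in_GammaL2 inv_in_GammaL2 \<phi> \<psi> by blast
    ultimately have "plane_isomorphism (plane_of f) (plane_of f') (\<lambda>v. (\<psi> \<circ> inv \<phi>) v + 0)"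
      by (intro GammaL2_plane_isomorphism[OF f f' _ one_neq_zero])
    then show "isomorphic_planes (plane_of f) (plane_of f')"
      unfolding isomorphic_planes_def by blast
  qed
  then show ?thesis using iff by blast
qed

end
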